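(* Let $K$ be a field of any characteristic, $x=(x_1,\ldots,x_n)$, and let $H\in K[x]^n$ be a quadratic polynomial map in dimension $n$ over $K$, such that $(\mathcal{J}H)^2=0$. Let $y=(y_1,\ldots,y_n)$ and $z=(z_1,\ldots,z_n)$ be two further $n$-tuples of indeterminates. Then the following holds. (i) $\mathcal{J}H$ is similar over $K$ to a triangular matrix. (ii) If $\tfrac12\in K$ and $H$ is homogeneous, then $(\mathcal{J}H)(x)\cdot(\mathcal{J}H)(y)=0$. (iii) If $\tfrac12\in K$ and $H$ is not (necessarily) homogeneous, then $(\mathcal{J}H)(x)\cdot(\mathcal{J}H)(y)\cdot(\mathcal{J}H)(z)=0$.
   Context: The degree of $H=(H_1,\ldots,H_n)$ is $\max_i\deg H_i$; quadratic means of degree at most $2$. $H$ is homogeneous if all terms of all components $H_i$ have the same degree. $\mathcal{J}H=\left(\frac{\partial H_i}{\partial x_j}\right)_{i,j}\in\operatorname{Mat}_n(K[x])$ is the Jacobian matrix with respect to $x$, and $(\mathcal{J}H)(v)$ denotes the result of substituting $v$ for $x$ in all entries of $\mathcal{J}H$. Matrices $M,\tilde M\in\operatorname{Mat}_n(K[x])$ are similar over $K$ if there is $T\in\operatorname{GL}_n(K)$ such that $\tilde M=T^{-1}MT$. A matrix is triangular if it is upper triangular or lower triangular. $\tfrac12\in K$ means that the characteristic of $K$ is not $2$. *)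

theory Defs
  imports "HOL-Library.Poly_Mapping" "Jordan_Normal_Form.Matrix"
begin

(* Polynomials over 'a in the indeterminates X 0, X 1, X 2, ...; a monomial is its finitely
   supported exponent function.  The ring K[x] with x = (x_1,...,x_n) consists of the polynomials
   whose indeterminates have index < n (the paper's x_{i+1} is X i); the indeterminates of higher
   index leave room for the additional tuples y and z. *)
type_synonym 'a mpoly = "(nat \<Rightarrow>\<^sub>0 nat) \<Rightarrow>\<^sub>0 'a"

definition Const :: "'a::comm_ring_1 \<Rightarrow> 'a mpoly" where
  "Const c = Poly_Mapping.single 0 c"

definition X :: "nat \<Rightarrow> 'a::comm_ring_1 mpoly" where
  "X i = Poly_Mapping.single (Poly_Mapping.single i 1) 1"

definition indets :: "'a::comm_ring_1 mpoly \<Rightarrow> nat set" where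
  "indets p = (\<Union>m\<in>Poly_Mapping.keys p. Poly_Mapping.keys m)"

definition monom_degree :: "(nat \<Rightarrow>\<^sub>0 nat) \<Rightarrow> nat" where
  "monom_degree m = (\<Sum>i\<in>Poly_Mapping.keys m. Poly_Mapping.lookup m i)"

(* Total degree; the zero polynomial gets degree 0. *)
definition total_degree :: "'a::comm_ring_1 mpoly \<Rightarrow> nat" where
  "total_degree p = Max (insert 0 (monom_degree ` Poly_Mapping.keys p))"

(* Formal partial derivative: c * x^m is sent to (m_j * c) * x^(m - e_j).  If m_j = 0, the
   subtraction of exponents truncates, but then the coefficient is 0. *)
definition partial_deriv :: "nat \<Rightarrow> 'a::comm_ring_1 mpoly \<Rightarrow> 'a mpoly" where
  "partial_deriv j p = (\<Sum>m\<in>Poly_Mapping.keys p.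
     Poly_Mapping.single (m - Poly_Mapping.single j 1)
       (of_nat (Poly_Mapping.lookup m j) * Poly_Mapping.lookup p m))"

definition mpoly_subst :: "(nat \<Rightarrow> 'a::comm_ring_1 mpoly) \<Rightarrow> 'a mpoly \<Rightarrow> 'a mpoly" where
  "mpoly_subst s p = (\<Sum>m\<in>Poly_Mapping.keys p.
     Const (Poly_Mapping.lookup p m)
       * (\<Prod>i\<in>Poly_Mapping.keys m. s i ^ Poly_Mapping.lookup m i))"

definition poly_maps :: "nat \<Rightarrow> 'a::comm_ring_1 mpoly vec set" where
  "poly_maps n = {H \<in> carrier_vec n. \<forall>i<n. indets (H $ i) \<subseteq> {..<n}}"

definition map_degree :: "'a::comm_ring_1 mpoly vec \<Rightarrow> nat" where
  "map_degree H = Max (insert 0 ((\<lambda>i. total_degree (H $ i)) ` {..<dim_vec H}))"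

definition quadratic_map :: "'a::comm_ring_1 mpoly vec \<Rightarrow> bool" where
  "quadratic_map H \<longleftrightarrow> map_degree H \<le> 2"

definition homogeneous_map :: "'a::comm_ring_1 mpoly vec \<Rightarrow> bool" where
  "homogeneous_map H \<longleftrightarrow>
     (\<exists>d. \<forall>i<dim_vec H. \<forall>m\<in>Poly_Mapping.keys (H $ i). monom_degree m = d)"

definition jacobian :: "'a::comm_ring_1 mpoly vec \<Rightarrow> 'a mpoly mat" where
  "jacobian H = mat (dim_vec H) (dim_vec H) (\<lambda>(i, j). partial_deriv j (H $ i))"

(* (JH)(v); only the entries of v below its dimension matter when H lies in poly_maps (dim_vec v). *)
definition jacobian_at :: "'a::comm_ring_1 mpoly vec \<Rightarrow> 'a mpoly vec \<Rightarrow> 'a mpoly mat" where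
  "jacobian_at H v = map_mat (mpoly_subst (\<lambda>i. v $ i)) (jacobian H)"

definition x_tuple :: "nat \<Rightarrow> 'a::comm_ring_1 mpoly vec" where
  "x_tuple n = vec n (\<lambda>i. X i)"

definition y_tuple :: "nat \<Rightarrow> 'a::comm_ring_1 mpoly vec" where
  "y_tuple n = vec n (\<lambda>i. X (n + i))"

definition z_tuple :: "nat \<Rightarrow> 'a::comm_ring_1 mpoly vec" where
  "z_tuple n = vec n (\<lambda>i. X (2 * n + i))"

(* N = T^(-1) M T with T in GL_n(K), where S plays the role of T^(-1); S and T have entries in
   the coefficient field.  (similar_mat over 'a mpoly would allow polynomial entries.) *)
definition similar_over_coeffs :: "nat \<Rightarrow> 'a::field mpoly mat \<Rightarrow> 'a mpoly mat \<Rightarrow> bool" where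
  "similar_over_coeffs n M N \<longleftrightarrow>
     (\<exists>S\<in>carrier_mat n n. \<exists>T\<in>carrier_mat n n.
        inverts_mat S T \<and> inverts_mat T S \<and> N = map_mat Const S * M * map_mat Const T)"

definition lower_triangular :: "'a::zero mat \<Rightarrow> bool" where
  "lower_triangular A \<longleftrightarrow> (\<forall>i<dim_row A. \<forall>j<dim_col A. i < j \<longrightarrow> A $$ (i, j) = 0)"

definition triangular :: "'a::zero mat \<Rightarrow> bool" where
  "triangular A \<longleftrightarrow> upper_triangular A \<or> lower_triangular A"

end

theory Submission
  imports Defs "Jordan_Normal_Form.Determinant"
begin

text \<open>The Jacobian of a quadratic map is \<open>\<Sum>k<n. x\<^sub>k C\<^sub>k + C\<^sub>n\<close> with constant matrices \<open>C\<^sub>k\<close>, and comparing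
  coefficients in its square shows that the \<open>C\<^sub>k\<close> (\<open>k \<le> n\<close>) square to zero and anticommute pairwise. Such a
  family has a common kernel vector: if \<open>v\<close> is annihilated by some of the matrices, then so is \<open>C\<^sub>l v\<close>, and
  \<open>C\<^sub>l\<close> annihilates it as well. Splitting off this vector and inducting on \<open>n\<close> gives (i).
  The symmetry \<open>C\<^sub>k e\<^sub>j = C\<^sub>j e\<^sub>k\<close> of the second derivatives, combined with anticommutativity, yields
  \<open>2 C\<^sub>k C\<^sub>l = 0\<close> for \<open>k, l < n\<close>, which is (ii). In a product of three of the matrices, anticommutativity
  brings either two factors of index below \<open>n\<close> or two copies of \<open>C\<^sub>n\<close> next to each other, hence (iii).\<close>

section \<open>Families of anticommuting square-zero matrices\<close>

text \<open>In characteristic 2 the anticommutator of a matrix with itself vanishes anyway, so the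
  squares are a separate condition. Together these are the relations between the generators of an
  exterior algebra.\<close>

definition anticommuting_square_zero :: "nat \<Rightarrow> 'i set \<Rightarrow> ('i \<Rightarrow> 'a::ring_1 mat) \<Rightarrow> bool" where
  "anticommuting_square_zero n I C \<longleftrightarrow>
     (\<forall>k\<in>I. C k \<in> carrier_mat n n \<and> C k * C k = 0\<^sub>m n n) \<and>
     (\<forall>k\<in>I. \<forall>l\<in>I. k \<noteq> l \<longrightarrow> C k * C l + C l * C k = 0\<^sub>m n n)"

lemma anticommuting_square_zeroD:
  assumes "anticommuting_square_zero n I C" "k \<in> I"
  shows "C k \<in> carrier_mat n n" "C k * C k = 0\<^sub>m n n"
  using assms by (simp_all add: anticommuting_square_zero_def)

lemma add_mat_eq_0_iff:
  fixes A B :: "'a::ab_group_add mat"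
  assumes "A \<in> carrier_mat n m" "B \<in> carrier_mat n m"
  shows "A + B = 0\<^sub>m n m \<longleftrightarrow> A = - B"
  using assms by (auto simp: mat_eq_iff eq_neg_iff_add_eq_0)

lemma anticommuting_square_zero_commute:
  assumes "anticommuting_square_zero n I C" "k \<in> I" "l \<in> I"
  shows "C k * C l = - (C l * C k)"
proof (cases "k = l")
  case True
  with assms show ?thesis
    by (auto simp: anticommuting_square_zero_def)
next
  case False
  with assms show ?thesis
    unfolding anticommuting_square_zero_def
    by (subst add_mat_eq_0_iff[symmetric, of _ n n]) (auto intro!: mult_carrier_mat[of _ n n])
qed

lemma uminus_mult_mat_vec:
  fixes A :: "'a::ring_1 mat"
  assumes "A \<in> carrier_mat n m" "v \<in> carrier_vec m"
  shows "(- A) *\<^sub>v v = - (A *\<^sub>v v)"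
  using assms by (intro eq_vecI) (auto simp: scalar_prod_def sum_negf)

lemma common_kernel_vector:
  fixes C :: "'i \<Rightarrow> 'a::field mat"
  assumes "finite I" "anticommuting_square_zero n I C" "n > 0"
  shows "\<exists>v\<in>carrier_vec n. v \<noteq> 0\<^sub>v n \<and> (\<forall>k\<in>I. C k *\<^sub>v v = 0\<^sub>v n)"
  using assms(1,2)
proof (induction rule: finite_induct)
  case empty
  show ?case
    \<comment> \<open>The empty family annihilates every vector; \<open>n > 0\<close> supplies a
      nonzero one.\<close>
    using assms(3) by (intro bexI[of _ "unit_vec n 0"]) auto
next
  case (insert l I)
  from insert.prems have "anticommuting_square_zero n I C"
    by (auto simp: anticommuting_square_zero_def)
  from insert.IH[OF this] obtain v where v: "v \<in> carrier_vec n" "v \<noteq> 0\<^sub>v n"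
    "\<And>k. k \<in> I \<Longrightarrow> C k *\<^sub>v v = 0\<^sub>v n" by auto
  note car = anticommuting_square_zeroD(1)[OF insert.prems]
  show ?case
  proof (cases "C l *\<^sub>v v = 0\<^sub>v n")
    case True
    with v show ?thesis by (intro bexI[of _ v]) auto
  next
    case False
    have "C k *\<^sub>v (C l *\<^sub>v v) = 0\<^sub>v n" if k: "k \<in> insert l I" for k
    proof -
      have "C k *\<^sub>v (C l *\<^sub>v v) = (C k * C l) *\<^sub>v v"
        using car[of k] car[of l] k v(1) by simp
      also have "\<dots> = 0\<^sub>v n"
      proof (cases "k = l")
        case True
        with anticommuting_square_zeroD(2)[OF insert.prems k] v(1) show ?thesis
          by auto
      next
        case False
        with k have kI: "k \<in> I" by simp
        have "(C k * C l) *\<^sub>v v = (- (C l * C k)) *\<^sub>v v"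
          using anticommuting_square_zero_commute[OF insert.prems, of k l] k by simp
        also have "\<dots> = - (C l *\<^sub>v (C k *\<^sub>v v))"
          using car[of k] car[of l] k v(1) by (subst uminus_mult_mat_vec[of _ n n]) auto
        also have "\<dots> = 0\<^sub>v n"
          using v(3)[OF kI] car[of l] by auto
        finally show ?thesis .
      qed
      finally show ?thesis .
    qed
    with False car[of l] v(1) show ?thesis
      by (intro bexI[of _ "C l *\<^sub>v v"]) auto
  qed
qed

text \<open>Completes \<open>v\<close> to a basis: at a position \<open>p\<close> where
  \<open>v\<close> does not vanish, the unit vector is replaced by \<open>v\<close>, which is listed
  first.\<close>

lemma exists_invertible_first_col:
  fixes v :: "'a::field vec"
  assumes v: "v \<in> carrier_vec n" "v \<noteq> 0\<^sub>v n"
  shows "\<exists>P\<in>carrier_mat n n. \<exists>Q\<in>carrier_mat n n. P * Q = 1\<^sub>m n \<and> Q * P = 1\<^sub>m n \<and> col P 0 = v"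
proof -
  obtain p where p: "p < n" "v $ p \<noteq> 0"
    using v by (metis carrier_vecD eq_vecI index_zero_vec)
  \<comment> \<open>\<open>s\<close> exchanges 0 and the pivot \<open>p\<close>, so
    \<open>s j\<close> for \<open>j > 0\<close> runs through the positions other than
    \<open>p\<close>; their unit vectors fill the remaining columns of \<open>P\<close>.\<close>
  define s where "s = transpose 0 p"
  have s: "s i < n" if "i < n" for i
    using that p by (auto simp: s_def transpose_def)
  have s_eq: "s i = s j \<longleftrightarrow> i = j" "s i = p \<longleftrightarrow> i = 0" "p = s i \<longleftrightarrow> i = 0" for i j
    by (auto simp: s_def transpose_def)
  define P where "P = mat n n (\<lambda>(i, j). if j = 0 then v $ i else if i = s j then 1 else 0)"
  \<comment> \<open>\<open>Q\<close> returns the coordinates of a vector \<open>w\<close> in the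
    basis of columns of \<open>P\<close>: the coefficient of \<open>v\<close> is
    \<open>w $ p / v $ p\<close>, and the others are read off at the positions \<open>s i\<close>
    after subtracting this multiple of \<open>v\<close>.\<close>
  define Q where "Q = mat n n (\<lambda>(i, j). if i = 0 then (if j = p then 1 / v $ p else 0)
    else (if j = s i then 1 else 0) - (if j = p then v $ s i / v $ p else 0))"
  have PQ: "P \<in> carrier_mat n n" "Q \<in> carrier_mat n n"
    by (auto simp: P_def Q_def)
  have "Q * P = 1\<^sub>m n"
  proof (rule eq_matI)
    fix i j assume "i < dim_row (1\<^sub>m n :: 'a mat)" "j < dim_col (1\<^sub>m n :: 'a mat)"
    then have ij: "i < n" "j < n" by auto
    have Q_row: "(\<Sum>k<n. Q $$ (i, k) * f k) =
        (if i = 0 then f p / v $ p else f (s i) - v $ s i / v $ p * f p)" for f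
    proof -
      have if_mult: "(if c then a else 0) * b = (if c then a * b else 0)" for c and a b :: 'a
        by simp
      show ?thesis
        using ij p s[of i]
        by (cases "i = 0") (simp_all add: Q_def left_diff_distrib sum_subtractf if_mult)
    qed
    have "(Q * P) $$ (i, j) = (\<Sum>k<n. Q $$ (i, k) * P $$ (k, j))"
      using ij PQ by (simp add: scalar_prod_def atLeast0LessThan)
    also have "\<dots> = (if i = j then 1 else 0)"
      unfolding Q_row using ij p s[of i] s[of j] by (auto simp: P_def s_eq)
    finally show "(Q * P) $$ (i, j) = 1\<^sub>m n $$ (i, j)" using ij by simp
  qed (use PQ in auto)
  moreover from this have "P * Q = 1\<^sub>m n"
    using PQ mat_mult_left_right_inverse by blast
  moreover have "col P 0 = v"
    using v p by (intro eq_vecI) (auto simp: P_def)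
  ultimately show ?thesis using PQ by blast
qed

text \<open>In a product of two conjugates \<open>P * Q\<close> cancels in the middle, so the
  relations carry over to the new family.\<close>

lemma anticommuting_square_zero_similar:
  fixes C :: "'i \<Rightarrow> 'a::field mat"
  assumes C: "anticommuting_square_zero n I C"
    and PQ: "P \<in> carrier_mat n n" "Q \<in> carrier_mat n n" "P * Q = 1\<^sub>m n"
  shows "anticommuting_square_zero n I (\<lambda>k. Q * C k * P)"
proof -
  have mult: "(Q * C k * P) * (Q * C l * P) = Q * (C k * C l) * P" if "k \<in> I" "l \<in> I" for k l
  proof -
    have car: "C k \<in> carrier_mat n n" "C l \<in> carrier_mat n n"
      using anticommuting_square_zeroD[OF C] that by blast+
    have "(Q * C k * P) * (Q * C l * P) = Q * C k * ((P * Q) * (C l * P))"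
      using car PQ(1,2) by (simp add: assoc_mult_mat[of _ n n _ n _ n])
    then show ?thesis
      using car PQ by (simp add: assoc_mult_mat[of _ n n _ n _ n])
  qed
  show ?thesis
    unfolding anticommuting_square_zero_def
  proof (intro conjI ballI impI)
    fix k assume k: "k \<in> I"
    note Ck = anticommuting_square_zeroD[OF C k]
    show "Q * C k * P \<in> carrier_mat n n" using PQ Ck(1) by simp
    show "(Q * C k * P) * (Q * C k * P) = 0\<^sub>m n n"
      unfolding mult[OF k k] Ck(2) using PQ(1,2) by simp
    fix l assume l: "l \<in> I" "k \<noteq> l"
    have car: "C k \<in> carrier_mat n n" "C l \<in> carrier_mat n n"
      using anticommuting_square_zeroD[OF C] k l by blast+
    have "Q * (C k * C l) * P + Q * (C l * C k) * P = Q * (C k * C l + C l * C k) * P"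
      using car PQ by (simp add: mult_add_distrib_mat[of _ n n _ n] add_mult_distrib_mat[of _ n n _ _ n])
    also have "\<dots> = 0\<^sub>m n n"
      using C k l PQ by (auto simp: anticommuting_square_zero_def)
    finally show "(Q * C k * P) * (Q * C l * P) + (Q * C l * P) * (Q * C k * P) = 0\<^sub>m n n"
      unfolding mult[OF k l(1)] mult[OF l(1) k] .
  qed
qed

section \<open>Block matrices and simultaneous triangularization\<close>

lemma four_block_mat_eq_0D:
  assumes "four_block_mat A B C D = 0\<^sub>m (n + m) (n + m)"
    "A \<in> carrier_mat n n" "B \<in> carrier_mat n m" "C \<in> carrier_mat m n" "D \<in> carrier_mat m m"
  shows "D = 0\<^sub>m m m"
proof (rule eq_matI)
  fix i j assume "i < dim_row (0\<^sub>m m m)" "j < dim_col (0\<^sub>m m m)"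
  then have ij: "i < m" "j < m" by auto
  then have "D $$ (i, j) = four_block_mat A B C D $$ (n + i, n + j)"
    using assms(2-) by simp
  also have "\<dots> = 0\<^sub>m m m $$ (i, j)"
    using ij by (simp add: assms(1))
  finally show "D $$ (i, j) = 0\<^sub>m m m $$ (i, j)" .
qed (use assms in auto)

lemma mult_four_block_mat_upper:
  fixes A\<^sub>1 :: "'a::ring_1 mat"
  assumes "A\<^sub>1 \<in> carrier_mat n n" "B\<^sub>1 \<in> carrier_mat n m" "D\<^sub>1 \<in> carrier_mat m m"
    and "A\<^sub>2 \<in> carrier_mat n n" "B\<^sub>2 \<in> carrier_mat n m" "D\<^sub>2 \<in> carrier_mat m m"
  shows "four_block_mat A\<^sub>1 B\<^sub>1 (0\<^sub>m m n) D\<^sub>1 * four_block_mat A\<^sub>2 B\<^sub>2 (0\<^sub>m m n) D\<^sub>2 =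
    four_block_mat (A\<^sub>1 * A\<^sub>2) (A\<^sub>1 * B\<^sub>2 + B\<^sub>1 * D\<^sub>2) (0\<^sub>m m n) (D\<^sub>1 * D\<^sub>2)"
proof -
  have "A\<^sub>1 * A\<^sub>2 + B\<^sub>1 * 0\<^sub>m m n = A\<^sub>1 * A\<^sub>2" "0\<^sub>m m n * A\<^sub>2 + D\<^sub>1 * 0\<^sub>m m n = 0\<^sub>m m n"
    "0\<^sub>m m n * B\<^sub>2 + D\<^sub>1 * D\<^sub>2 = D\<^sub>1 * D\<^sub>2"
    using assms by simp_all
  then show ?thesis
    using mult_four_block_mat[OF assms(1,2) zero_carrier_mat assms(3-5) zero_carrier_mat assms(6)]
    by simp
qed

text \<open>Induction on \<open>n\<close>: in a basis starting with a common kernel vector all first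
  columns vanish, and the lower right blocks form a family of the same kind in one dimension
  less.\<close>

lemma simultaneously_upper_triangular:
  fixes C :: "'i \<Rightarrow> 'a::field mat"
  assumes "finite I" "anticommuting_square_zero n I C"
  shows "\<exists>S\<in>carrier_mat n n. \<exists>T\<in>carrier_mat n n. S * T = 1\<^sub>m n \<and> T * S = 1\<^sub>m n \<and>
    (\<forall>k\<in>I. upper_triangular (S * C k * T))"
  using assms(2)
proof (induction n arbitrary: C)
  case 0
  then show ?case
    by (intro bexI[of _ "1\<^sub>m 0"]) (auto simp: anticommuting_square_zero_def)
next
  case (Suc n)
  obtain v where v: "v \<in> carrier_vec (Suc n)" "v \<noteq> 0\<^sub>v (Suc n)"
    "\<And>k. k \<in> I \<Longrightarrow> C k *\<^sub>v v = 0\<^sub>v (Suc n)"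
    using common_kernel_vector[OF assms(1) Suc.prems] by auto
  obtain P Q where PQ: "P \<in> carrier_mat (Suc n) (Suc n)" "Q \<in> carrier_mat (Suc n) (Suc n)"
    "P * Q = 1\<^sub>m (Suc n)" "Q * P = 1\<^sub>m (Suc n)" "col P 0 = v"
    using exists_invertible_first_col[OF v(1,2)] by blast
  define M where "M = (\<lambda>k. Q * C k * P)"
  have M: "anticommuting_square_zero (Suc n) I M"
    unfolding M_def by (rule anticommuting_square_zero_similar[OF Suc.prems PQ(1-3)])
  define R where "R = (\<lambda>k. mat 1 n (\<lambda>(i, j). M k $$ (0, Suc j)))"
  define D where "D = (\<lambda>k. mat n n (\<lambda>(i, j). M k $$ (Suc i, Suc j)))"
  have RD [simp]: "R k \<in> carrier_mat 1 n" "D k \<in> carrier_mat n n" for k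
    by (auto simp: R_def D_def)
  have RD_mult [simp]: "R k * D l \<in> carrier_mat 1 n" "D k * D l \<in> carrier_mat n n" for k l
    by (rule mult_carrier_mat[OF RD(1) RD(2)], rule mult_carrier_mat[OF RD(2) RD(2)])
  have Mcar: "M k \<in> carrier_mat (Suc n) (Suc n)" if "k \<in> I" for k
    by (rule anticommuting_square_zeroD(1)[OF M that])
  have col0: "M k $$ (i, 0) = 0" if "k \<in> I" "i < Suc n" for k i
  proof -
    have car: "C k \<in> carrier_mat (Suc n) (Suc n)"
      by (rule anticommuting_square_zeroD(1)[OF Suc.prems that(1)])
    have "col (M k) 0 = Q *\<^sub>v (C k *\<^sub>v col P 0)"
      unfolding M_def using PQ(1,2,5) car v(1)
      by (subst col_mult2[of _ "Suc n" "Suc n" _ "Suc n"]) (auto intro!: assoc_mult_mat_vec)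
    also have "\<dots> = 0\<^sub>v (Suc n)"
      using v(3)[OF that(1)] PQ by auto
    finally have "col (M k) 0 $ i = 0" using that by simp
    then show ?thesis using Mcar[OF that(1)] that by simp
  qed
  have M_eq: "M k = four_block_mat (0\<^sub>m 1 1) (R k) (0\<^sub>m n 1) (D k)" if "k \<in> I" for k
    using Mcar[OF that] col0[OF that]
    by (intro eq_matI) (auto simp: R_def D_def)
  have mult: "M k * M l = four_block_mat (0\<^sub>m 1 1) (R k * D l) (0\<^sub>m n 1) (D k * D l)"
    if "k \<in> I" "l \<in> I" for k l
    unfolding M_eq[OF that(1)] M_eq[OF that(2)]
    by (simp only: mult_four_block_mat_upper[OF zero_carrier_mat RD zero_carrier_mat RD]
        left_mult_zero_mat[OF zero_carrier_mat] left_mult_zero_mat[OF RD(1)] left_add_zero_mat[OF RD_mult(1)])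
  \<comment> \<open>\<open>D k\<close> is the action on the quotient by the line of
    \<open>v\<close>. Taking lower right blocks respects sums and products here, so the relations
    descend.\<close>
  have "anticommuting_square_zero n I D"
    unfolding anticommuting_square_zero_def
  proof (intro conjI ballI impI)
    fix k assume k: "k \<in> I"
    have "M k * M k = 0\<^sub>m (1 + n) (1 + n)"
      using anticommuting_square_zeroD(2)[OF M k] by simp
    then show "D k * D k = 0\<^sub>m n n"
      unfolding mult[OF k k] by (rule four_block_mat_eq_0D) (auto simp del: One_nat_def)
    fix l assume l: "l \<in> I" "k \<noteq> l"
    have "M k * M l + M l * M k = 0\<^sub>m (1 + n) (1 + n)"
      using M k l by (auto simp: anticommuting_square_zero_def)
    moreover have "M k * M l + M l * M k =
      four_block_mat (0\<^sub>m 1 1) (R k * D l + R l * D k) (0\<^sub>m n 1) (D k * D l + D l * D k)"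
      unfolding mult[OF k l(1)] mult[OF l(1) k]
      by (subst add_four_block_mat[of _ 1 1 _ n _ n]) (auto simp del: One_nat_def)
    ultimately show "D k * D l + D l * D k = 0\<^sub>m n n"
      by (intro four_block_mat_eq_0D[of "0\<^sub>m 1 1" "R k * D l + R l * D k" "0\<^sub>m n 1" _ 1 n])
        (auto simp del: One_nat_def)
  qed auto
  from Suc.IH[OF this] obtain S T where ST: "S \<in> carrier_mat n n" "T \<in> carrier_mat n n"
    "S * T = 1\<^sub>m n" "T * S = 1\<^sub>m n" "\<And>k. k \<in> I \<Longrightarrow> upper_triangular (S * D k * T)"
    by blast
  \<comment> \<open>The change of basis in the quotient is extended by fixing the first basis
    vector. Combined with \<open>P\<close> and \<open>Q\<close>, the conjugating pair becomes
    \<open>S' * Q\<close> and \<open>P * T'\<close>.\<close>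
  define S' where "S' = four_block_mat (1\<^sub>m 1) (0\<^sub>m 1 n) (0\<^sub>m n 1) S"
  define T' where "T' = four_block_mat (1\<^sub>m 1) (0\<^sub>m 1 n) (0\<^sub>m n 1) T"
  have car: "S' \<in> carrier_mat (Suc n) (Suc n)" "T' \<in> carrier_mat (Suc n) (Suc n)"
    using ST by (auto simp: S'_def T'_def)
  have one: "four_block_mat (1\<^sub>m 1) (0\<^sub>m 1 n) (0\<^sub>m n 1) (1\<^sub>m n) = (1\<^sub>m (Suc n) :: 'a mat)"
    by (intro eq_matI) auto
  have "S' * T' = 1\<^sub>m (Suc n)" "T' * S' = 1\<^sub>m (Suc n)"
    unfolding S'_def T'_def using ST
    by (auto simp: mult_four_block_mat[of _ 1 1 _ n _ n _ _ 1 _ n] one)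
  note ST' = this
  have "(S' * Q) * (P * T') = S' * ((Q * P) * T')" "(P * T') * (S' * Q) = P * ((T' * S') * Q)"
    using car PQ(1,2) by (simp_all add: assoc_mult_mat[of _ "Suc n" "Suc n" _ "Suc n" _ "Suc n"])
  then have inv: "(S' * Q) * (P * T') = 1\<^sub>m (Suc n)" "(P * T') * (S' * Q) = 1\<^sub>m (Suc n)"
    using car PQ ST' by simp_all
  have "upper_triangular ((S' * Q) * C k * (P * T'))" if k: "k \<in> I" for k
  proof -
    have SD: "S * D k \<in> carrier_mat n n"
      by (rule mult_carrier_mat[OF ST(1) RD(2)])
    have "C k \<in> carrier_mat (Suc n) (Suc n)"
      by (rule anticommuting_square_zeroD(1)[OF Suc.prems k])
    with car PQ(1,2) have "(S' * Q) * C k * (P * T') = S' * M k * T'"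
      unfolding M_def
      by (simp only: assoc_mult_mat[of _ "Suc n" "Suc n" _ "Suc n" _ "Suc n"]
          mult_carrier_mat[of _ "Suc n" "Suc n"])
    also have "S' * M k = four_block_mat (0\<^sub>m 1 1) (R k) (0\<^sub>m n 1) (S * D k)"
      unfolding M_eq[OF k] S'_def
      by (simp only: mult_four_block_mat_upper[OF one_carrier_mat zero_carrier_mat ST(1) zero_carrier_mat RD]
          left_mult_one_mat[OF zero_carrier_mat] left_mult_one_mat[OF RD(1)] left_mult_zero_mat[OF RD(2)]
          right_add_zero_mat[OF RD(1)])
    also have "\<dots> * T' = four_block_mat (0\<^sub>m 1 1) (R k * T) (0\<^sub>m n 1) (S * D k * T)"
      unfolding T'_def
      by (simp only: mult_four_block_mat_upper[OF zero_carrier_mat RD(1) SD one_carrier_mat zero_carrier_mat ST(2)]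
          left_mult_zero_mat[OF one_carrier_mat] left_mult_zero_mat[OF zero_carrier_mat]
          left_add_zero_mat[OF mult_carrier_mat[OF RD(1) ST(2)]])
    finally show ?thesis
      using ST(5)[OF k] mult_carrier_mat[OF SD ST(2)]
      by (simp only:) (intro upper_triangular_four_block[of _ 1 _ n], auto)
  qed
  then show ?case
    using inv mult_carrier_mat[OF car(1) PQ(2)] mult_carrier_mat[OF PQ(1) car(2)] by blast
qed

section \<open>Pencils of constant matrices\<close>

lemma Const_0 [simp]: "Const 0 = 0"
  by (simp add: Const_def)

lemma Const_1 [simp]: "Const 1 = 1"
  by (simp add: Const_def)

lemma Const_mult: "Const (a * b) = Const a * Const b"
  by (simp add: Const_def mult_single)

lemma Const_sum: "Const (sum f A) = (\<Sum>x\<in>A. Const (f x))"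
  by (induction A rule: infinite_finite_induct) (auto simp: Const_def single_add)

text \<open>A combination of constant matrices with polynomial scalars. The index type is left open
  so that products can be indexed by pairs.\<close>

definition pencil ::
    "nat \<Rightarrow> 'i set \<Rightarrow> ('i \<Rightarrow> 'a::comm_ring_1 mat) \<Rightarrow> ('i \<Rightarrow> 'a mpoly) \<Rightarrow> 'a mpoly mat" where
  "pencil n I C v = mat n n (\<lambda>(i, j). \<Sum>k\<in>I. Const (C k $$ (i, j)) * v k)"

lemma pencil_carrier [simp]: "pencil n I C v \<in> carrier_mat n n"
  and dim_row_pencil [simp]: "dim_row (pencil n I C v) = n"
  and dim_col_pencil [simp]: "dim_col (pencil n I C v) = n"
  by (auto simp: pencil_def)

lemma index_pencil:
  "i < n \<Longrightarrow> j < n \<Longrightarrow> pencil n I C v $$ (i, j) = (\<Sum>k\<in>I. Const (C k $$ (i, j)) * v k)"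
  by (simp add: pencil_def)

lemma pencil_eq_0: "(\<And>k. k \<in> I \<Longrightarrow> C k = 0\<^sub>m n n) \<Longrightarrow> pencil n I C v = 0\<^sub>m n n"
  by (intro eq_matI) (auto simp: index_pencil)

lemma upper_triangular_pencil:
  assumes "\<And>k. k \<in> I \<Longrightarrow> C k \<in> carrier_mat n n \<and> upper_triangular (C k)"
  shows "upper_triangular (pencil n I C v)"
proof (rule upper_triangularI)
  fix i j assume ij: "j < i" "i < dim_row (pencil n I C v)"
  have "C k $$ (i, j) = 0" if "k \<in> I" for k
    using assms[OF that] ij by (auto simp: upper_triangular_def)
  with ij show "pencil n I C v $$ (i, j) = 0"
    by (simp add: index_pencil)
qed

text \<open>Makes conjugation by a constant matrix an instance of the product rule for
  pencils.\<close>

lemma pencil_const: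
  "S \<in> carrier_mat n n \<Longrightarrow> map_mat Const S = pencil n {()} (\<lambda>_. S) (\<lambda>_. 1)"
  by (intro eq_matI) (auto simp: index_pencil)

text \<open>The scalars \<open>u k\<close> and \<open>v l\<close> live in a commutative ring and
  move past the constant matrices. Questions about products of Jacobians thus become questions about
  products of constant matrices.\<close>

lemma pencil_mult:
  assumes "\<And>k. k \<in> I \<Longrightarrow> C k \<in> carrier_mat n n" "\<And>l. l \<in> J \<Longrightarrow> D l \<in> carrier_mat n n"
  shows "pencil n I C u * pencil n J D v =
    pencil n (I \<times> J) (\<lambda>(k, l). C k * D l) (\<lambda>(k, l). u k * v l)"
proof (rule eq_matI)
  fix i j
  assume "i < dim_row (pencil n (I \<times> J) (\<lambda>(k, l). C k * D l) (\<lambda>(k, l). u k * v l))"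
    and "j < dim_col (pencil n (I \<times> J) (\<lambda>(k, l). C k * D l) (\<lambda>(k, l). u k * v l))"
  then have ij: "i < n" "j < n" by auto
  have "(pencil n I C u * pencil n J D v) $$ (i, j) =
      (\<Sum>m<n. (\<Sum>k\<in>I. Const (C k $$ (i, m)) * u k) * (\<Sum>l\<in>J. Const (D l $$ (m, j)) * v l))"
    using ij by (simp add: scalar_prod_def index_pencil atLeast0LessThan)
  also have "\<dots> = (\<Sum>m<n. \<Sum>x\<in>I \<times> J. Const (C (fst x) $$ (i, m)) * u (fst x) *
      (Const (D (snd x) $$ (m, j)) * v (snd x)))"
    by (simp add: sum_product sum.cartesian_product case_prod_beta)
  also have "\<dots> = (\<Sum>x\<in>I \<times> J. \<Sum>m<n. Const (C (fst x) $$ (i, m)) * u (fst x) *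
      (Const (D (snd x) $$ (m, j)) * v (snd x)))"
    by (rule sum.swap)
  also have "\<dots> = (\<Sum>x\<in>I \<times> J. Const ((C (fst x) * D (snd x)) $$ (i, j)) * (u (fst x) * v (snd x)))"
  proof (rule sum.cong)
    fix x assume x: "x \<in> I \<times> J"
    have "C (fst x) \<in> carrier_mat n n" "D (snd x) \<in> carrier_mat n n"
      using assms x by auto
    then have "(C (fst x) * D (snd x)) $$ (i, j) = (\<Sum>m<n. C (fst x) $$ (i, m) * D (snd x) $$ (m, j))"
      using ij by (simp add: scalar_prod_def atLeast0LessThan)
    then show "(\<Sum>m<n. Const (C (fst x) $$ (i, m)) * u (fst x) * (Const (D (snd x) $$ (m, j)) * v (snd x))) =
        Const ((C (fst x) * D (snd x)) $$ (i, j)) * (u (fst x) * v (snd x))"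
      by (simp add: Const_sum Const_mult sum_distrib_right sum_distrib_left mult_ac)
  qed simp
  also have "\<dots> = pencil n (I \<times> J) (\<lambda>(k, l). C k * D l) (\<lambda>(k, l). u k * v l) $$ (i, j)"
    using ij by (simp add: index_pencil case_prod_beta)
  finally show "(pencil n I C u * pencil n J D v) $$ (i, j) =
    pencil n (I \<times> J) (\<lambda>(k, l). C k * D l) (\<lambda>(k, l). u k * v l) $$ (i, j)" .
qed auto

section \<open>Polynomials of degree at most one\<close>

lemma lookup_partial_deriv:
  "Poly_Mapping.lookup (partial_deriv j p) m =
    of_nat (Suc (Poly_Mapping.lookup m j)) * Poly_Mapping.lookup p (m + Poly_Mapping.single j 1)"
proof -
  let ?e = "Poly_Mapping.single j (1::nat)"
  have "(of_nat (Poly_Mapping.lookup m' j) * Poly_Mapping.lookup p m' when m' - ?e = m) =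
      (if m' = m + ?e then of_nat (Suc (Poly_Mapping.lookup m j)) * Poly_Mapping.lookup p (m + ?e) else 0)" for m'
  proof (cases "m' = m + ?e")
    case True
    then show ?thesis by (simp add: lookup_add)
  next
    case False
    \<comment> \<open>Truncated subtraction may also send a monomial without the variable
      \<open>j\<close> to \<open>m\<close>, but then the factor coming from the exponent is
      0.\<close>
    have "Poly_Mapping.lookup m' j = 0" if "m' - ?e = m"
    proof (rule ccontr)
      assume "Poly_Mapping.lookup m' j \<noteq> 0"
      then have "m' = (m' - ?e) + ?e"
        by (intro poly_mapping_eqI) (auto simp: lookup_add lookup_minus lookup_single when_def)
      with that False show False by simp
    qed
    with False show ?thesis by (auto simp: when_def)
  qed
  then have "Poly_Mapping.lookup (partial_deriv j p) m = (\<Sum>m'\<in>Poly_Mapping.keys p.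
      if m' = m + ?e then of_nat (Suc (Poly_Mapping.lookup m j)) * Poly_Mapping.lookup p (m + ?e) else 0)"
    by (simp add: partial_deriv_def lookup_sum lookup_single)
  also have "\<dots> = of_nat (Suc (Poly_Mapping.lookup m j)) * Poly_Mapping.lookup p (m + ?e)"
    by (auto simp: in_keys_iff)
  finally show ?thesis .
qed

lemma monom_degree_eq_sum:
  assumes "finite A" "Poly_Mapping.keys m \<subseteq> A"
  shows "monom_degree m = (\<Sum>i\<in>A. Poly_Mapping.lookup m i)"
  unfolding monom_degree_def using assms
  by (intro sum.mono_neutral_left) (auto simp: in_keys_iff)

lemma monom_degree_add_single:
  "monom_degree (m + Poly_Mapping.single j 1) = Suc (monom_degree m)"
proof -
  let ?A = "insert j (Poly_Mapping.keys m)"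
  have "monom_degree (m + Poly_Mapping.single j 1) = (\<Sum>i\<in>?A. Poly_Mapping.lookup m i + Poly_Mapping.lookup (Poly_Mapping.single j 1) i)"
    by (subst monom_degree_eq_sum[of ?A]) (auto simp: lookup_add in_keys_iff lookup_single when_def split: if_splits)
  also have "\<dots> = monom_degree m + 1"
    by (subst monom_degree_eq_sum[of ?A m])
      (auto simp: sum.distrib lookup_single when_def simp del: sum.insert)
  finally show ?thesis by simp
qed

text \<open>The index \<open>n\<close> stands for a homogenizing variable with value 1, so that the constant term of
  an affine form is treated like the linear ones.\<close>

definition affine_monom :: "nat \<Rightarrow> nat \<Rightarrow> nat \<Rightarrow>\<^sub>0 nat" where
  "affine_monom n k = (if k < n then Poly_Mapping.single k 1 else 0)"

definition affine_value :: "nat \<Rightarrow> (nat \<Rightarrow> 'a::one) \<Rightarrow> nat \<Rightarrow> 'a" where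
  "affine_value n s k = (if k < n then s k else 1)"

lemma lookup_affine_monom: "Poly_Mapping.lookup (affine_monom n k) i = (if k = i \<and> k < n then 1 else 0)"
  by (simp add: affine_monom_def lookup_single when_def)

lemma inj_on_affine_monom: "inj_on (affine_monom n) {..n}"
proof (rule inj_onI)
  fix a b assume ab: "a \<in> {..n}" "b \<in> {..n}" and eq: "affine_monom n a = affine_monom n b"
  have "a = i \<and> a < n \<longleftrightarrow> b = i \<and> b < n" for i
    using arg_cong[OF eq, of "\<lambda>m. Poly_Mapping.lookup m i"]
    by (auto simp: lookup_affine_monom split: if_splits)
  from this[of a] this[of b] ab show "a = b"
    by fastforce
qed

text \<open>After homogenization this is unique factorization for products of two variables. It
  separates the contributions of different index pairs to the square of the Jacobian.\<close>

lemma affine_monom_add_eqD: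
  assumes le: "a \<le> n" "b \<le> n" "c \<le> n" "d \<le> n"
    and eq: "affine_monom n a + affine_monom n b = affine_monom n c + affine_monom n d"
  shows "a = c \<and> b = d \<or> a = d \<and> b = c"
proof -
  define f where "f = (\<lambda>k i. if k = i \<and> k < n then 1 else (0::nat))"
  have f: "f a i + f b i = f c i + f d i" for i
    using arg_cong[OF eq, of "\<lambda>m. Poly_Mapping.lookup m i"]
    by (simp only: lookup_add lookup_affine_monom f_def)
  consider "a = c" | "a = d" | "a \<noteq> c" "a \<noteq> d" by blast
  then show ?thesis
  proof cases
    case 1
    with eq have "affine_monom n b = affine_monom n d" by (simp only: add_left_cancel)
    with le have "b = d" by (simp add: inj_on_eq_iff[OF inj_on_affine_monom])
    with 1 show ?thesis by blast
  next
    case 2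
    with eq have "affine_monom n b = affine_monom n c"
      by (simp only: add.commute[of "affine_monom n c"] add_left_cancel)
    with le have "b = c" by (simp add: inj_on_eq_iff[OF inj_on_affine_monom])
    with 2 show ?thesis by blast
  next
    \<comment> \<open>Impossible: the exponent of \<open>a\<close> forces \<open>a = n\<close>, so
      \<open>c\<close> and \<open>d\<close> are actual variables; their exponents force
      \<open>b = c = d\<close>, and this variable would occur once on the left but twice on the
      right.\<close>
    case 3
    have "a = n"
    proof (rule ccontr)
      assume "a \<noteq> n"
      with le 3 have "f a a = 1" "f c a = 0" "f d a = 0" by (auto simp: f_def)
      with f[of a] show False by linarith
    qed
    with le 3 have cd: "f a i = 0" "f c c = 1" "f d d = 1" for i by (auto simp: f_def)
    have "b = c" by (rule ccontr) (use f[of c] cd in \<open>simp add: f_def\<close>)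
    moreover have "b = d" by (rule ccontr) (use f[of d] cd in \<open>simp add: f_def\<close>)
    ultimately have "f c c = f c c + f c c" using f[of c] cd by simp
    with cd show ?thesis by simp
  qed
qed

lemma affine_monom_cases:
  assumes "Poly_Mapping.keys m \<subseteq> {..<n}" "monom_degree m \<le> 1"
  shows "m \<in> affine_monom n ` {..n}"
proof (cases "Poly_Mapping.keys m = {}")
  case True
  then have "m = affine_monom n n" by (simp add: affine_monom_def)
  then show ?thesis by blast
next
  case False
  then obtain k where k: "k \<in> Poly_Mapping.keys m" by blast
  have "Poly_Mapping.lookup m k + (\<Sum>i\<in>Poly_Mapping.keys m - {k}. Poly_Mapping.lookup m i) \<le> 1"
    using assms(2) k by (simp add: monom_degree_def sum.remove)
  moreover have "Poly_Mapping.lookup m k \<noteq> 0" using k by (simp add: in_keys_iff)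
  ultimately have "Poly_Mapping.lookup m k = 1"
    and "(\<Sum>i\<in>Poly_Mapping.keys m - {k}. Poly_Mapping.lookup m i) = 0" by linarith+
  then have "Poly_Mapping.lookup m k = 1" "\<forall>i\<in>Poly_Mapping.keys m - {k}. Poly_Mapping.lookup m i = 0"
    by (simp_all only: sum_eq_0_iff finite_Diff finite_keys)
  then have "Poly_Mapping.lookup m i = (if i = k then 1 else 0)" for i
    by (metis DiffI in_keys_iff singletonD)
  then have "m = affine_monom n k"
    using k assms(1) by (intro poly_mapping_eqI) (auto simp: lookup_affine_monom simp del: One_nat_def)
  then show ?thesis using k assms(1) by auto
qed

text \<open>Passes from the support of \<open>q\<close> to an index range independent of
  \<open>q\<close>; the second assumption makes the added terms vanish.\<close>

lemma sum_keys_affine: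
  fixes q :: "'a::comm_ring_1 mpoly"
  assumes "Poly_Mapping.keys q \<subseteq> affine_monom n ` {..n}" "\<And>m. Poly_Mapping.lookup q m = 0 \<Longrightarrow> f m = 0"
  shows "(\<Sum>m\<in>Poly_Mapping.keys q. f m) = (\<Sum>k\<le>n. f (affine_monom n k))"
proof -
  have "(\<Sum>m\<in>Poly_Mapping.keys q. f m) = (\<Sum>m\<in>affine_monom n ` {..n}. f m)"
    using assms by (intro sum.mono_neutral_left) (auto simp: in_keys_iff)
  then show ?thesis
    by (simp add: sum.reindex inj_on_affine_monom)
qed

lemma affine_value_X: "affine_value n X k = Poly_Mapping.single (affine_monom n k) 1"
  by (simp add: affine_value_def affine_monom_def X_def)

lemma affine_expansion:
  assumes "Poly_Mapping.keys q \<subseteq> affine_monom n ` {..n}"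
  shows "q = (\<Sum>k\<le>n. Const (Poly_Mapping.lookup q (affine_monom n k)) * affine_value n X k)"
proof -
  have "q = (\<Sum>m\<in>Poly_Mapping.keys q. Poly_Mapping.single m (Poly_Mapping.lookup q m))"
    by (intro poly_mapping_eqI) (auto simp: lookup_sum lookup_single when_def in_keys_iff)
  also have "\<dots> = (\<Sum>k\<le>n. Poly_Mapping.single (affine_monom n k) (Poly_Mapping.lookup q (affine_monom n k)))"
    by (rule sum_keys_affine[OF assms]) simp
  finally show ?thesis
    by (simp add: affine_value_X Const_def mult_single)
qed

lemma mpoly_subst_affine:
  assumes "Poly_Mapping.keys q \<subseteq> affine_monom n ` {..n}"
  shows "mpoly_subst s q = (\<Sum>k\<le>n. Const (Poly_Mapping.lookup q (affine_monom n k)) * affine_value n s k)"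
proof -
  have "mpoly_subst s q = (\<Sum>k\<le>n. Const (Poly_Mapping.lookup q (affine_monom n k)) *
      (\<Prod>i\<in>Poly_Mapping.keys (affine_monom n k). s i ^ Poly_Mapping.lookup (affine_monom n k) i))"
    unfolding mpoly_subst_def by (rule sum_keys_affine[OF assms]) simp
  also have "\<dots> = (\<Sum>k\<le>n. Const (Poly_Mapping.lookup q (affine_monom n k)) * affine_value n s k)"
    by (intro sum.cong) (auto simp: affine_monom_def affine_value_def)
  finally show ?thesis .
qed

section \<open>The Jacobian of a quadratic map\<close>

text \<open>For \<open>k < dim_vec H\<close> this is the constant matrix multiplying
  \<open>X k\<close> in the Jacobian, for \<open>k = dim_vec H\<close> the constant part.\<close>

definition jacobian_coeff :: "'a::comm_ring_1 mpoly vec \<Rightarrow> nat \<Rightarrow> 'a mat" where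
  "jacobian_coeff H k = mat (dim_vec H) (dim_vec H)
     (\<lambda>(i, j). Poly_Mapping.lookup (partial_deriv j (H $ i)) (affine_monom (dim_vec H) k))"

lemma keys_partial_deriv_add:
  assumes "m \<in> Poly_Mapping.keys (partial_deriv j p)"
  shows "m + Poly_Mapping.single j 1 \<in> Poly_Mapping.keys p"
  using assms by (auto simp: in_keys_iff lookup_partial_deriv)

text \<open>Differentiation introduces no new variables and lowers the degree of each surviving
  monomial by one, so the entries of the Jacobian are affine forms.\<close>

lemma keys_partial_deriv_quadratic:
  assumes H: "H \<in> poly_maps n" "quadratic_map H" and i: "i < n"
  shows "Poly_Mapping.keys (partial_deriv j (H $ i)) \<subseteq> affine_monom n ` {..n}"
proof
  fix m assume "m \<in> Poly_Mapping.keys (partial_deriv j (H $ i))"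
  then have m: "m + Poly_Mapping.single j 1 \<in> Poly_Mapping.keys (H $ i)" by (rule keys_partial_deriv_add)
  have "Poly_Mapping.keys m \<subseteq> Poly_Mapping.keys (m + Poly_Mapping.single j 1)"
    by (auto simp: in_keys_iff lookup_add)
  also have "\<dots> \<subseteq> {..<n}"
    using H(1) i m by (auto simp: poly_maps_def indets_def)
  finally have "Poly_Mapping.keys m \<subseteq> {..<n}" .
  moreover have "monom_degree m \<le> 1"
  proof -
    have "Suc (monom_degree m) \<le> total_degree (H $ i)"
      unfolding total_degree_def monom_degree_add_single[of m j, symmetric]
      using m by (intro Max_ge) (auto simp del: One_nat_def)
    also have "\<dots> \<le> map_degree H"
      unfolding map_degree_def using H(1) i by (intro Max_ge) (auto simp: poly_maps_def)
    finally show ?thesis using H(2) by (simp add: quadratic_map_def)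
  qed
  ultimately show "m \<in> affine_monom n ` {..n}" by (rule affine_monom_cases)
qed

lemma jacobian_pencil:
  assumes "H \<in> poly_maps n" "quadratic_map H"
  shows "jacobian H = pencil n {..n} (jacobian_coeff H) (affine_value n X)"
proof -
  have dim: "dim_vec H = n" using assms(1) by (simp add: poly_maps_def)
  show ?thesis
    by (rule eq_matI) (use affine_expansion[OF keys_partial_deriv_quadratic[OF assms]] in
      \<open>auto simp: index_pencil jacobian_def jacobian_coeff_def dim\<close>)
qed

lemma jacobian_at_pencil:
  assumes "H \<in> poly_maps n" "quadratic_map H"
  shows "jacobian_at H v = pencil n {..n} (jacobian_coeff H) (affine_value n (($) v))"
proof -
  have dim: "dim_vec H = n" using assms(1) by (simp add: poly_maps_def)
  show ?thesis
    by (rule eq_matI) (use mpoly_subst_affine[OF keys_partial_deriv_quadratic[OF assms]] in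
      \<open>auto simp: index_pencil jacobian_def jacobian_at_def jacobian_coeff_def dim\<close>)
qed

lemma anticommuting_jacobian_coeff:
  fixes H :: "'a::comm_ring_1 mpoly vec"
  assumes H: "H \<in> poly_maps n" "quadratic_map H" and sq: "jacobian H ^\<^sub>m 2 = 0\<^sub>m n n"
  shows "anticommuting_square_zero n {..n} (jacobian_coeff H)"
proof -
  define C where "C = jacobian_coeff H"
  have dim: "dim_vec H = n" using H(1) by (simp add: poly_maps_def)
  have car: "C k \<in> carrier_mat n n" for k by (simp add: C_def jacobian_coeff_def dim)
  have "jacobian H * jacobian H = 0\<^sub>m n n"
  proof -
    have "jacobian H \<in> carrier_mat n n" by (simp add: jacobian_def dim)
    with sq show ?thesis by (simp add: numeral_2_eq_2)
  qed
  then have zero: "pencil n ({..n} \<times> {..n}) (\<lambda>(k, l). C k * C l)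
      (\<lambda>(k, l). affine_value n X k * affine_value n X l) = 0\<^sub>m n n"
    unfolding jacobian_pencil[OF H] C_def[symmetric] by (subst (asm) pencil_mult) (auto simp: car)
  \<comment> \<open>Summing over a set counts the pair once if \<open>k = l\<close>. This yields the
    square itself and not twice the square, which matters in characteristic 2.\<close>
  have pair: "(\<Sum>x\<in>{(k, l), (l, k)}. (C (fst x) * C (snd x)) $$ (i, j)) = 0"
    if kl: "k \<le> n" "l \<le> n" and ij: "i < n" "j < n" for k l i j
  proof -
    let ?m = "affine_monom n k + affine_monom n l"
    have eq_iff: "affine_monom n (fst x) + affine_monom n (snd x) = ?m \<longleftrightarrow> x \<in> {(k, l), (l, k)}"
      if "x \<in> {..n} \<times> {..n}" for x
      using that affine_monom_add_eqD[of "fst x" n "snd x" k l] kl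
      by (cases x) (auto simp: add.commute)
    have "0 = Poly_Mapping.lookup (pencil n ({..n} \<times> {..n}) (\<lambda>(k, l). C k * C l)
      (\<lambda>(k, l). affine_value n X k * affine_value n X l) $$ (i, j)) ?m"
      unfolding zero using ij by simp
    also have "\<dots> = (\<Sum>x\<in>{..n} \<times> {..n}. (C (fst x) * C (snd x)) $$ (i, j)
        when affine_monom n (fst x) + affine_monom n (snd x) = ?m)"
      unfolding index_pencil[OF ij] lookup_sum
      by (simp add: split_beta affine_value_X Const_def mult_single lookup_single del: index_mult_mat(1))
    also have "\<dots> = (\<Sum>x\<in>{..n} \<times> {..n}.
        if x \<in> {(k, l), (l, k)} then (C (fst x) * C (snd x)) $$ (i, j) else 0)"
      by (rule sum.cong[OF refl]) (simp only: eq_iff when_def)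
    also have "\<dots> = (\<Sum>x\<in>({..n} \<times> {..n}) \<inter> {(k, l), (l, k)}. (C (fst x) * C (snd x)) $$ (i, j))"
      by (rule sum.inter_restrict[symmetric]) simp
    also have "({..n} \<times> {..n}) \<inter> {(k, l), (l, k)} = {(k, l), (l, k)}"
      using kl by blast
    finally show ?thesis by (rule sym)
  qed
  show ?thesis
    unfolding anticommuting_square_zero_def C_def[symmetric]
  proof (intro conjI ballI impI)
    fix k assume k: "k \<in> {..n}"
    show "C k \<in> carrier_mat n n" by (rule car)
    show "C k * C k = 0\<^sub>m n n"
    proof (rule eq_matI)
      fix i j assume "i < dim_row (0\<^sub>m n n :: 'a mat)" "j < dim_col (0\<^sub>m n n :: 'a mat)"
      then show "(C k * C k) $$ (i, j) = 0\<^sub>m n n $$ (i, j)"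
        using pair[of k k i j] k by (simp del: index_mult_mat(1))
    qed (use car[of k] in auto)
    fix l assume l: "l \<in> {..n}" "k \<noteq> l"
    show "C k * C l + C l * C k = 0\<^sub>m n n"
    proof (rule eq_matI)
      fix i j assume "i < dim_row (0\<^sub>m n n :: 'a mat)" "j < dim_col (0\<^sub>m n n :: 'a mat)"
      then show "(C k * C l + C l * C k) $$ (i, j) = 0\<^sub>m n n $$ (i, j)"
        using pair[of k l i j] k l car[of k] car[of l]
        by (simp del: index_mult_mat(1))
    qed (use car[of k] car[of l] in auto)
  qed
qed

section \<open>Symmetry of second derivatives and vanishing products of coefficient matrices\<close>

lemma jacobian_coeff_symmetric:
  assumes "dim_vec H = n" "i < n" "j < n" "k < n"
  shows "jacobian_coeff H k $$ (i, j) = jacobian_coeff H j $$ (i, k)"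
proof -
  \<comment> \<open>Differentiating by \<open>X j\<close> and reading off \<open>X k\<close> gives
    the coefficient of \<open>X j * X k\<close>, doubled if \<open>j = k\<close>; this is symmetric
    in \<open>j\<close> and \<open>k\<close>.\<close>
  have coeff: "jacobian_coeff H k $$ (i, j) = of_nat (if k = j then 2 else 1) *
      Poly_Mapping.lookup (H $ i) (Poly_Mapping.single k 1 + Poly_Mapping.single j 1)"
    if "j < n" "k < n" for j k
    using assms(1,2) that
    by (simp add: jacobian_coeff_def lookup_partial_deriv affine_monom_def lookup_single when_def)
  show ?thesis
  proof (cases "j = k")
    case False
    then show ?thesis
      unfolding coeff[OF assms(3,4)] coeff[OF assms(4,3)]
      by (simp only: False False[symmetric] if_False add.commute)
  qed simp
qed

lemma two_neq_0_of_CHAR: "CHAR('k::field) \<noteq> 2 \<Longrightarrow> (2::'k) \<noteq> 0"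
proof
  assume char: "CHAR('k) \<noteq> 2" and "(2::'k) = 0"
  then have "of_nat 2 = (0::'k)" by simp
  then have "CHAR('k) dvd 2" by (simp only: of_nat_eq_0_iff_char_dvd)
  then have "CHAR('k) \<le> 2" "CHAR('k) \<noteq> 0" by (auto dest: dvd_imp_le intro!: Nat.gr0I)
  with char CHAR_not_1[where 'a='k] show False by linarith
qed

text \<open>The form \<open>(k, l, j) \<mapsto> (C k * C l) e\<^sub>j\<close> is antisymmetric in \<open>k, l\<close> and symmetric in
  \<open>l, j\<close>; transporting the sign around a 3-cycle makes it equal to its negative.\<close>

lemma jacobian_coeff_mult_eq_0:
  fixes H :: "'k::field mpoly vec"
  assumes dim: "dim_vec H = n" and C: "anticommuting_square_zero n {..n} (jacobian_coeff H)"
    and char: "CHAR('k) \<noteq> 2" and kl: "k < n" "l < n"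
  shows "jacobian_coeff H k * jacobian_coeff H l = 0\<^sub>m n n"
proof -
  define T where "T = (\<lambda>i k l j. (jacobian_coeff H k * jacobian_coeff H l) $$ (i, j))"
  have car: "jacobian_coeff H k \<in> carrier_mat n n" for k
    by (simp add: jacobian_coeff_def dim)
  \<comment> \<open>The symmetry is applied to the right factor: column \<open>j\<close> of matrix
    \<open>l\<close> is column \<open>l\<close> of matrix \<open>j\<close>.\<close>
  have sym: "T i k l j = T i k j l" if "i < n" "k < n" "l < n" "j < n" for i k l j
  proof -
    have "T i k l j = (\<Sum>m<n. jacobian_coeff H k $$ (i, m) * jacobian_coeff H l $$ (m, j))"
      if "l < n" "j < n" for l j
      using that \<open>i < n\<close> car[of k] car[of l] by (simp add: T_def scalar_prod_def atLeast0LessThan)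
    then show ?thesis
      using that jacobian_coeff_symmetric[OF dim] by (auto intro!: sum.cong)
  qed
  have alt: "T i k l j = - T i l k j" if "i < n" "k < n" "l < n" "j < n" for i k l j
    using that car[of k] car[of l] anticommuting_square_zero_commute[OF C, of k l]
    by (simp add: T_def del: index_mult_mat(1))
  show ?thesis
  proof (rule eq_matI)
    fix i j assume "i < dim_row (0\<^sub>m n n :: 'k mat)" "j < dim_col (0\<^sub>m n n :: 'k mat)"
    then have ij: "i < n" "j < n" by auto
    have "T i k l j = - T i l k j" using ij kl by (intro alt)
    also have "T i l k j = T i l j k" using ij kl by (intro sym)
    also have "T i l j k = - T i j l k" using ij kl by (intro alt)
    also have "T i j l k = T i j k l" using ij kl by (intro sym)
    also have "T i j k l = - T i k j l" using ij kl by (intro alt)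
    also have "T i k j l = T i k l j" using ij kl by (intro sym)
    finally have "T i k l j = - T i k l j" by (simp only: minus_minus)
    then have "T i k l j + T i k l j = 0" by (simp only: eq_neg_iff_add_eq_0)
    then have "2 * T i k l j = 0" by (simp only: mult_2)
    then have "T i k l j = 0" using two_neq_0_of_CHAR[OF char] by simp
    then show "(jacobian_coeff H k * jacobian_coeff H l) $$ (i, j) = 0\<^sub>m n n $$ (i, j)"
      using ij by (simp add: T_def)
  qed (use car[of k] car[of l] in auto)
qed

text \<open>All monomials of the derivatives have degree one less than \<open>d\<close>, so the
  linear or the constant part of the Jacobian vanishes. Mixed products thus have a zero factor; the
  others are covered by the case of two indices below \<open>n\<close> or are the square at index
  \<open>n\<close>.\<close>

lemma jacobian_coeff_mult_eq_0_homogeneous: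
  fixes H :: "'k::field mpoly vec"
  assumes dim: "dim_vec H = n" and C: "anticommuting_square_zero n {..n} (jacobian_coeff H)"
    and char: "CHAR('k) \<noteq> 2" and hom: "homogeneous_map H" and kl: "k \<le> n" "l \<le> n"
  shows "jacobian_coeff H k * jacobian_coeff H l = 0\<^sub>m n n"
proof -
  obtain d where d: "\<And>i m. i < n \<Longrightarrow> m \<in> Poly_Mapping.keys (H $ i) \<Longrightarrow> monom_degree m = d"
    using hom dim by (auto simp: homogeneous_map_def)
  have car: "jacobian_coeff H k \<in> carrier_mat n n" for k
    by (simp add: jacobian_coeff_def dim)
  have zero: "jacobian_coeff H a = 0\<^sub>m n n" if "Suc (monom_degree (affine_monom n a)) \<noteq> d" for a
  proof (rule eq_matI)
    fix i j assume "i < dim_row (0\<^sub>m n n :: 'k mat)" "j < dim_col (0\<^sub>m n n :: 'k mat)"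
    then have ij: "i < n" "j < n" by auto
    have "affine_monom n a \<notin> Poly_Mapping.keys (partial_deriv j (H $ i))"
      using that d[OF ij(1)] keys_partial_deriv_add monom_degree_add_single by metis
    then show "jacobian_coeff H a $$ (i, j) = 0\<^sub>m n n $$ (i, j)"
      using ij by (simp add: jacobian_coeff_def dim in_keys_iff)
  qed (use car[of a] in auto)
  have deg: "monom_degree (affine_monom n a) = (if a < n then 1 else 0)" for a
    by (simp add: affine_monom_def monom_degree_def)
  consider "k < n" "l < n" | "k = n" "l = n" | "jacobian_coeff H k = 0\<^sub>m n n" |
    "jacobian_coeff H l = 0\<^sub>m n n"
  proof (cases "k < n \<longleftrightarrow> l < n")
    case True
    with kl that(1,2) show ?thesis by linarith
  next
    case False
    then have "monom_degree (affine_monom n k) \<noteq> monom_degree (affine_monom n l)" by (simp add: deg)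
    then have "Suc (monom_degree (affine_monom n k)) \<noteq> d \<or> Suc (monom_degree (affine_monom n l)) \<noteq> d"
      by linarith
    with zero that(3,4) show ?thesis by blast
  qed
  then show ?thesis
  proof cases
    case 1
    then show ?thesis by (rule jacobian_coeff_mult_eq_0[OF dim C char])
  qed (use C car[of k] car[of l] in \<open>auto simp: anticommuting_square_zero_def\<close>)
qed

text \<open>By pigeonhole, two of the three indices both lie in \<open>I\<close> or both equal
  \<open>b\<close>. If these are the outer two, exchanging the first two factors makes them adjacent
  at the cost of a sign.\<close>

lemma anticommuting_square_zero_triple:
  fixes C :: "'i \<Rightarrow> 'a::ring_1 mat"
  assumes C: "anticommuting_square_zero n (insert b I) C"
    and zero: "\<And>k l. k \<in> I \<Longrightarrow> l \<in> I \<Longrightarrow> C k * C l = 0\<^sub>m n n"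
    and klm: "k \<in> insert b I" "l \<in> insert b I" "m \<in> insert b I"
  shows "C k * C l * C m = 0\<^sub>m n n"
proof -
  have car: "C k \<in> carrier_mat n n" "C l \<in> carrier_mat n n" "C m \<in> carrier_mat n n"
    and bb: "C b * C b = 0\<^sub>m n n"
    using anticommuting_square_zeroD[OF C] klm by blast+
  have assoc: "C k * C l * C m = C k * (C l * C m)"
    using car by simp
  have swap: "C k * C l * C m = - (C l * (C k * C m))"
    using car by (simp add: anticommuting_square_zero_commute[OF C klm(1,2)])
  consider "C k * C l = 0\<^sub>m n n" | "C l * C m = 0\<^sub>m n n" | "C k * C m = 0\<^sub>m n n"
    using klm bb zero by blast
  then show ?thesis
  proof cases
    case 1
    then show ?thesis by (simp only: left_mult_zero_mat[OF car(3)])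
  next
    case 2
    then show ?thesis by (simp only: assoc right_mult_zero_mat[OF car(1)])
  next
    case 3
    then have "C k * C l * C m = - 0\<^sub>m n n"
      by (simp only: swap right_mult_zero_mat[OF car(2)])
    also have "\<dots> = 0\<^sub>m n n" by (intro eq_matI) auto
    finally show ?thesis .
  qed
qed

section \<open>The three claims, reduced to products of the coefficient matrices\<close>

theorem theorem3p3:
  fixes H :: "'k::field mpoly vec" and n :: nat
  assumes "H \<in> poly_maps n"
    and "quadratic_map H"
    and "jacobian H ^\<^sub>m 2 = 0\<^sub>m n n"
  shows "(\<exists>N. similar_over_coeffs n (jacobian H) N \<and> triangular N) \<and>
    (CHAR('k) \<noteq> 2 \<and> homogeneous_map H \<longrightarrow>
      jacobian_at H (x_tuple n) * jacobian_at H (y_tuple n) = 0\<^sub>m n n) \<and>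
    (CHAR('k) \<noteq> 2 \<longrightarrow>
      jacobian_at H (x_tuple n) * jacobian_at H (y_tuple n) * jacobian_at H (z_tuple n) = 0\<^sub>m n n)"
proof (intro conjI impI)
  let ?C = "jacobian_coeff H"
  have dim: "dim_vec H = n" using assms(1) by (simp add: poly_maps_def)
  have C: "anticommuting_square_zero n {..n} ?C"
    by (rule anticommuting_jacobian_coeff[OF assms])
  have car: "?C k \<in> carrier_mat n n" for k by (simp add: jacobian_coeff_def dim)
  show "\<exists>N. similar_over_coeffs n (jacobian H) N \<and> triangular N"
  proof -
    obtain S T where ST: "S \<in> carrier_mat n n" "T \<in> carrier_mat n n"
      "S * T = 1\<^sub>m n" "T * S = 1\<^sub>m n" "\<And>k. k \<in> {..n} \<Longrightarrow> upper_triangular (S * ?C k * T)"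
      using simultaneously_upper_triangular[OF _ C] by blast
    \<comment> \<open>As a product of three pencils, the conjugated Jacobian is the pencil of the
      matrices \<open>S * ?C k * T\<close>, all of them upper triangular.\<close>
    have "upper_triangular (map_mat Const S * jacobian H * map_mat Const T)"
      unfolding jacobian_pencil[OF assms(1,2)] pencil_const[OF ST(1)] pencil_const[OF ST(2)]
      using ST car by (auto simp: pencil_mult mult_carrier_mat[of _ n n] split_beta intro!: upper_triangular_pencil)
    moreover have "similar_over_coeffs n (jacobian H) (map_mat Const S * jacobian H * map_mat Const T)"
      unfolding similar_over_coeffs_def using ST by (auto simp: inverts_mat_def)
    ultimately show ?thesis by (auto simp: triangular_def)
  qed
  \<comment> \<open>Every coefficient matrix of the product pencil vanishes, whatever tuples are
    substituted.\<close>
  show "jacobian_at H (x_tuple n) * jacobian_at H (y_tuple n) = 0\<^sub>m n n"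
    if "CHAR('k) \<noteq> 2 \<and> homogeneous_map H"
    unfolding jacobian_at_pencil[OF assms(1,2)]
    using that jacobian_coeff_mult_eq_0_homogeneous[OF dim C]
    by (auto simp: pencil_mult car intro!: pencil_eq_0)
  show "jacobian_at H (x_tuple n) * jacobian_at H (y_tuple n) * jacobian_at H (z_tuple n) = 0\<^sub>m n n"
    if char: "CHAR('k) \<noteq> 2"
  proof -
    \<comment> \<open>The index \<open>n\<close> of the constant part is the exceptional one;
      products of two matrices with indices below \<open>n\<close> vanish.\<close>
    have "{..n} = insert n {..<n}" by auto
    then have "?C k * ?C l * ?C m = 0\<^sub>m n n" if "k \<le> n" "l \<le> n" "m \<le> n" for k l m
      using that C by (intro anticommuting_square_zero_triple[of n n "{..<n}"])
        (auto intro: jacobian_coeff_mult_eq_0[OF dim C char])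
    then show ?thesis
      unfolding jacobian_at_pencil[OF assms(1,2)]
      by (auto simp: pencil_mult car mult_carrier_mat[of _ n n] split_beta intro!: pencil_eq_0)
  qed
qed

end
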